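(* Let $\mathbb{F}$ be a field in which every quadratic and every cubic polynomial has a root. Every nontrivial two-dimensional algebra over $\mathbb{F}$ has exactly zero, exactly one, exactly two, or infinitely many nontrivial (that is, one-dimensional) left ideals; likewise, it has exactly zero, exactly one, exactly two, or infinitely many nontrivial right ideals.
   Context: An algebra is a vector space with a bilinear product (not necessarily associative, commutative or unital); it is nontrivial if its product is not identically zero. A one-dimensional subspace $\mathbb{F}\mathbf u$ of $\mathbb{A}$ is a left (right) ideal if $\mathbf v\mathbf u\in\mathbb{F}\mathbf u$ (respectively $\mathbf u\mathbf v\in\mathbb{F}\mathbf u$) for all $\mathbf v\in\mathbb{A}$. *)

theory Defs
  imports Complex_Main "HOL-Computational_Algebra.Polynomial"
begin

locale algebra_over = vector_space scale
  for scale :: "'k::field \<Rightarrow> 'a::ab_group_add \<Rightarrow> 'a" +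
  fixes mult :: "'a \<Rightarrow> 'a \<Rightarrow> 'a"
  assumes linear_mult_right: "\<And>x. Vector_Spaces.linear scale scale (\<lambda>y. mult x y)"
    and linear_mult_left: "\<And>y. Vector_Spaces.linear scale scale (\<lambda>x. mult x y)"
begin

definition nontrivial_product :: bool where
  "nontrivial_product \<longleftrightarrow> (\<exists>x y. mult x y \<noteq> 0)"

definition one_dim_left_ideals :: "'a set set" where
  "one_dim_left_ideals = {span {u} | u. u \<noteq> 0 \<and> (\<forall>v. mult v u \<in> span {u})}"

definition one_dim_right_ideals :: "'a set set" where
  "one_dim_right_ideals = {span {u} | u. u \<noteq> 0 \<and> (\<forall>v. mult u v \<in> span {u})}"

end

definition quadratics_and_cubics_have_roots :: "'k::field itself \<Rightarrow> bool" where
  "quadratics_and_cubics_have_roots _ \<longleftrightarrow>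
     (\<forall>p :: 'k poly. degree p = 2 \<or> degree p = 3 \<longrightarrow> (\<exists>x. poly p x = 0))"

end

theory Submission imports Defs begin

text \<open>A one-dimensional left (right) ideal is a common eigenline of all left (right) multiplications.
  In dimension two, if three different lines are invariant under a linear operator, then the
  operator is a scalar; so three common eigenlines force every line to be one, and there are
  infinitely many lines because the field is infinite.\<close>

text \<open>Roots of \<open>x^2 + x - c\<close> for every \<open>c\<close> make
  \<open>x * (x + 1)\<close> surjective. On a finite field it would then be injective, yet it
  vanishes at both \<open>0\<close> and \<open>- 1\<close>.\<close>

lemma infinite_field_if_quadratics_have_roots:
  assumes "\<And>p :: 'k::field poly. degree p = 2 \<Longrightarrow> \<exists>x. poly p x = 0"
  shows "infinite (UNIV :: 'k set)"
proof
  assume fin: "finite (UNIV :: 'k set)"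
  \<comment> \<open>Plain squaring would not do: it is injective in characteristic 2. The two zeros
    of \<open>g\<close> differ in every characteristic.\<close>
  define g :: "'k \<Rightarrow> 'k" where "g x = x * (x + 1)" for x
  have "\<exists>x. g x = c" for c
  proof -
    have "degree [:- c, 1, 1:] = 2" by simp
    from assms[OF this] obtain x where "poly [:- c, 1, 1:] x = 0" by blast
    then have "g x = c" by (simp add: g_def algebra_simps)
    then show ?thesis by blast
  qed
  then have "surj g" by (metis surjI)
  with fin have "inj g" by (rule finite_UNIV_surj_inj)
  moreover have "g 0 = g (- 1)" by (simp add: g_def)
  ultimately show False by (metis injD neg_equal_0_iff_equal zero_neq_one)
qed

context vector_space
begin

lemma span_singleton_eq_if_mem:
  assumes "x \<in> span {y}" "x \<noteq> 0"
  shows "span {x} = span {y}"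
proof -
  obtain k where k: "x = k *s y" using assms(1) by (auto simp: span_singleton)
  with assms(2) have "k \<noteq> 0" by auto
  then have "y = inverse k *s x" by (simp add: k)
  then have "y \<in> span {x}" by (metis span_base span_scale singletonI)
  with assms(1) show ?thesis by (simp add: span_eq)
qed

lemma span_pair_eq_UNIV_if_dim_eq_2:
  assumes dim: "dim UNIV = 2" and ind: "independent {a, b}" and "a \<noteq> b"
  shows "span {a, b} = UNIV"
proof -
  obtain B where B: "UNIV \<subseteq> span B" "card B = 2"
    using basis_exists[of UNIV] dim by metis
  \<comment> \<open>An infinite set has \<open>card\<close> 0, so cardinality 2 forces
    finiteness.\<close>
  then have "finite B" using card.infinite by fastforce
  have "x \<in> span {a, b}" for x
  proof (rule ccontr)
    assume x: "x \<notin> span {a, b}"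
    then have "independent {x, a, b}" using ind by (simp add: independent_insertI)
    moreover have "{x, a, b} \<subseteq> span B" using B(1) by blast
    ultimately have "card {x, a, b} \<le> 2"
      using independent_span_bound[OF \<open>finite B\<close>] B(2) by metis
    moreover have "x \<notin> {a, b}" using x span_base by blast
    ultimately show False using \<open>a \<noteq> b\<close> by simp
  qed
  then show ?thesis by blast
qed

text \<open>The family \<open>f\<close> lets one argument serve both sides: \<open>f v\<close> will
  be left multiplication by \<open>v\<close> for left ideals and right multiplication by
  \<open>v\<close> for right ideals.\<close>

lemma card_common_eigenlines_le_2:
  fixes f :: "'i \<Rightarrow> 'b \<Rightarrow> 'b"
  assumes field: "infinite (UNIV :: 'a set)" and dim: "dim UNIV = 2"
    and lin: "\<And>v. Vector_Spaces.linear scale scale (f v)"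
  defines "E \<equiv> {span {u} |u. u \<noteq> 0 \<and> (\<forall>v. f v u \<in> span {u})}"
  assumes fin: "finite E"
  shows "card E \<le> 2"
proof (rule ccontr)
  assume "\<not> card E \<le> 2"
  then have "3 \<le> card E" by simp
  then obtain T where T: "T \<subseteq> E" "card T = 3" by (meson obtain_subset_with_card_n)
  then obtain A B C where "T = {A, B, C}" and ne: "A \<noteq> B" "A \<noteq> C" "B \<noteq> C"
    by (auto simp: card_3_iff)
  with T have "A \<in> E" "B \<in> E" "C \<in> E" by auto
  then obtain a b c where a: "A = span {a}" "a \<noteq> 0" "\<And>v. f v a \<in> span {a}"
    and b: "B = span {b}" "b \<noteq> 0" "\<And>v. f v b \<in> span {b}"
    and c: "C = span {c}" "c \<noteq> 0" "\<And>v. f v c \<in> span {c}"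
    unfolding E_def by blast
  have anb: "a \<notin> span {b}" using span_singleton_eq_if_mem a b ne by blast
  have "a \<noteq> b" using a b ne by blast
  have ind: "independent {a, b}"
    using anb b(2) by (simp add: independent_insert)
  have coords: "r = 0 \<and> s = 0" if "r *s a + s *s b = 0" for r s
  proof -
    have "r = 0"
    proof (rule ccontr)
      assume "r \<noteq> 0"
      have "r *s a = (- s) *s b" using that by (simp add: eq_neg_iff_add_eq_0)
      then have "a = (inverse r * (- s)) *s b"
        using \<open>r \<noteq> 0\<close> by (metis scale_scale left_inverse scale_one)
      with anb show False by (metis span_base span_scale singletonI)
    qed
    with that b(2) show ?thesis by simp
  qed
  have UN: "span {a, b} = UNIV"
    using span_pair_eq_UNIV_if_dim_eq_2 dim ind \<open>a \<noteq> b\<close> by blast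
  have combo: "\<exists>r s. x = r *s a + s *s b" for x
  proof -
    have "x \<in> span {a, b}" using UN by simp
    then obtain r where "x - r *s a \<in> span {b}" by (auto simp: span_breakdown_eq[of x])
    then obtain s where "x - r *s a = s *s b" by (auto simp: span_singleton)
    then have "x = r *s a + s *s b" by (simp add: algebra_simps)
    then show ?thesis by blast
  qed
  obtain r s where rs: "c = r *s a + s *s b" using combo by blast
  \<comment> \<open>If a coordinate of \<open>c\<close> vanished, the line \<open>C\<close> would
    coincide with \<open>B\<close> or \<open>A\<close>. Both coordinates get cancelled when
    eigenvalues are compared.\<close>
  have "r \<noteq> 0"
  proof
    assume "r = 0"
    then have "c \<in> span {b}" using rs by (simp add: span_base span_scale)
    then show False using span_singleton_eq_if_mem b c ne by blast
  qed
  have "s \<noteq> 0"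
  proof
    assume "s = 0"
    then have "c \<in> span {a}" using rs by (simp add: span_base span_scale)
    then show False using span_singleton_eq_if_mem a c ne by blast
  qed
  \<comment> \<open>Expanding \<open>f v c\<close> through \<open>a\<close> and \<open>b\<close> and
    comparing with \<open>n *s c\<close> forces the three eigenvalues to agree, so
    \<open>f v\<close> is the scalar \<open>n\<close>, which may depend on \<open>v\<close>.\<close>
  have every: "f v u \<in> span {u}" for v u
  proof -
    obtain l where l: "f v a = l *s a" using a(3) by (auto simp: span_singleton)
    obtain m where m: "f v b = m *s b" using b(3) by (auto simp: span_singleton)
    obtain n where n: "f v c = n *s c" using c(3) by (auto simp: span_singleton)
    interpret F: Vector_Spaces.linear scale scale "f v" by (rule lin)
    have "r *s (l *s a) + s *s (m *s b) = n *s (r *s a + s *s b)"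
      using n by (simp add: rs F.add F.scale l m)
    then have "(r * (l - n)) *s a + (s * (m - n)) *s b = 0"
      by (simp add: algebra_simps)
    from coords[OF this] have "l = n" "m = n" using \<open>r \<noteq> 0\<close> \<open>s \<noteq> 0\<close> by auto
    moreover obtain p q where "u = p *s a + q *s b" using combo by blast
    ultimately have "f v u = n *s u"
      by (simp add: F.add F.scale l m scale_right_distrib mult.commute)
    then show ?thesis by (simp add: span_base span_scale)
  qed
  \<comment> \<open>These are the lines other than \<open>B\<close>, parametrized by slope; they
    embed the infinite field into \<open>E\<close>.\<close>
  define line where "line t = span {a + t *s b}" for t
  have nz: "a + t *s b \<noteq> 0" for t using coords[of 1 t] by auto
  have "inj line"
  proof (rule injI)
    fix t t' assume "line t = line t'"
    then have "a + t *s b \<in> span {a + t' *s b}"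
      unfolding line_def by (metis span_base singletonI)
    then obtain k where "a + t *s b = k *s (a + t' *s b)" by (auto simp: span_singleton)
    \<comment> \<open>The coefficient of \<open>a\<close> gives \<open>k = 1\<close>, and then that
      of \<open>b\<close> gives \<open>t = t'\<close>.\<close>
    then have "(1 - k) *s a + (t - k * t') *s b = 0" by (simp add: algebra_simps)
    from coords[OF this] show "t = t'" by simp
  qed
  moreover have "range line \<subseteq> E" using every nz unfolding E_def line_def by blast
  ultimately show False using field fin by (meson finite_imageD finite_subset)
qed

end

theorem mainTheorem12:
  fixes scale :: "'k::field \<Rightarrow> 'a::ab_group_add \<Rightarrow> 'a"
    and mult :: "'a \<Rightarrow> 'a \<Rightarrow> 'a"
  assumes "quadratics_and_cubics_have_roots TYPE('k)"
    and "algebra_over scale mult"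
    and "vector_space.dim scale (UNIV :: 'a set) = 2"
    and "algebra_over.nontrivial_product mult"
  defines "L \<equiv> algebra_over.one_dim_left_ideals scale mult"
    and "R \<equiv> algebra_over.one_dim_right_ideals scale mult"
  shows "(L = {} \<or> card L = 1 \<or> card L = 2 \<or> infinite L) \<and>
         (R = {} \<or> card R = 1 \<or> card R = 2 \<or> infinite R)"
proof -
  interpret algebra_over scale mult by fact
  have field: "infinite (UNIV :: 'k set)"
    using assms(1) infinite_field_if_quadratics_have_roots
    unfolding quadratics_and_cubics_have_roots_def by blast
  have count: "X = {} \<or> card X = 1 \<or> card X = 2 \<or> infinite X"
    if "finite X \<Longrightarrow> card X \<le> 2" for X :: "'a set set"
  proof (cases "finite X")
    case True
    then have "card X = 0 \<or> card X = 1 \<or> card X = 2" using that by linarith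
    \<comment> \<open>Finiteness is what turns \<open>card X = 0\<close> into
      \<open>X = {}\<close>.\<close>
    with True show ?thesis by auto
  qed simp
  have "finite L \<Longrightarrow> card L \<le> 2"
    unfolding L_def one_dim_left_ideals_def
    \<comment> \<open>For a left ideal the generator is the right factor of \<open>mult v u\<close>,
      hence linearity in the right argument; for right ideals the roles swap.\<close>
    by (rule card_common_eigenlines_le_2[OF field assms(3) linear_mult_right])
  moreover have "finite R \<Longrightarrow> card R \<le> 2"
    unfolding R_def one_dim_right_ideals_def
    by (rule card_common_eigenlines_le_2[OF field assms(3) linear_mult_left])
  ultimately show ?thesis using count by blast
qed

end
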